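(* Let $X$ be a regular curve and let $f:X\to X$ be a homeomorphism. Then $h_{\mathrm{pol}}(f)\leqslant 1$.
   Context: A continuum is a nonempty connected compact metric space. A continuum $X$ is a regular curve if for each $x\in X$ and each open neighbourhood $U$ of $x$ in $X$ there exists an open neighbourhood $V$ of $x$ in $X$ such that $V\subset U$ and the boundary $\partial V$ is finite. Polynomial entropy: let $(X,d)$ be a compact metric space and $f:X\to X$ continuous. For $n\geq 1$ put $d_n^f(x,y)=\max_{0\leq k\leq n-1}d(f^k(x),f^k(y))$. For $\varepsilon>0$, a finite set $E\subset X$ is $(n,\varepsilon)$-separated if $d_n^f(x,y)\geq\varepsilon$ for all distinct $x,y\in E$; $\mathrm{sep}(n,\varepsilon)$ denotes the maximal cardinality of an $(n,\varepsilon)$-separated subset of $X$. Then $$h_{\mathrm{pol}}(f)=\lim_{\varepsilon\to 0}\limsup_{n\to\infty}\frac{\log \mathrm{sep}(n,\varepsilon)}{\log n}.$$ *)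

theory Defs
  imports "HOL-Analysis.Analysis"
begin

definition continuum :: "'a::metric_space set \<Rightarrow> bool" where
  "continuum X \<longleftrightarrow> X \<noteq> {} \<and> connected X \<and> compact X"

text \<open>Neighbourhoods and boundaries are taken in the subspace \<open>X\<close>, not in the ambient type.\<close>

definition regular_curve :: "'a::metric_space set \<Rightarrow> bool" where
  "regular_curve X \<longleftrightarrow> continuum X \<and>
     (\<forall>x\<in>X. \<forall>U. openin (top_of_set X) U \<and> x \<in> U \<longrightarrow>
        (\<exists>V. openin (top_of_set X) V \<and> x \<in> V \<and> V \<subseteq> U \<and>
             finite (top_of_set X frontier_of V)))"

text \<open>Intended for \<open>n \<ge> 1\<close>; truncated subtraction makes \<open>n = 0\<close> coincide with \<open>n = 1\<close>.\<close>

definition dyn_dist :: "('a::metric_space \<Rightarrow> 'a) \<Rightarrow> nat \<Rightarrow> 'a \<Rightarrow> 'a \<Rightarrow> real" where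
  "dyn_dist f n x y = Max ((\<lambda>k. dist ((f ^^ k) x) ((f ^^ k) y)) ` {0..n - 1})"

definition separated_set ::
    "'a::metric_space set \<Rightarrow> ('a \<Rightarrow> 'a) \<Rightarrow> nat \<Rightarrow> real \<Rightarrow> 'a set \<Rightarrow> bool" where
  "separated_set X f n \<epsilon> E \<longleftrightarrow> finite E \<and> E \<subseteq> X \<and>
     (\<forall>x\<in>E. \<forall>y\<in>E. x \<noteq> y \<longrightarrow> \<epsilon> \<le> dyn_dist f n x y)"

definition sep :: "'a::metric_space set \<Rightarrow> ('a \<Rightarrow> 'a) \<Rightarrow> nat \<Rightarrow> real \<Rightarrow> nat" where
  "sep X f n \<epsilon> = Max {card E |E. separated_set X f n \<epsilon> E}"

definition pol_entropy :: "'a::metric_space set \<Rightarrow> ('a \<Rightarrow> 'a) \<Rightarrow> ereal" where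
  "pol_entropy X f = Lim (at_right (0::real))
     (\<lambda>\<epsilon>. limsup (\<lambda>n. ereal (ln (real (sep X f n \<epsilon>)) / ln (real n))))"

text \<open>
  The maximum in \<open>sep\<close> and the limit in \<open>pol_entropy\<close> are total operators, unspecified when the
  set of cardinalities is infinite or the limit does not exist. For a continuous self-map of a
  nonempty compact set neither happens.
\<close>

lemma dyn_dist_less_iff:
  "dyn_dist f n x y < \<epsilon> \<longleftrightarrow> (\<forall>k\<le>n - 1. dist ((f ^^ k) x) ((f ^^ k) y) < \<epsilon>)"
  unfolding dyn_dist_def by (subst Max_less_iff) auto

lemma funpow_mem: "f ` X \<subseteq> X \<Longrightarrow> x \<in> X \<Longrightarrow> (f ^^ k) x \<in> X"
  by (induction k) auto

lemma continuous_on_funpow: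
  fixes f :: "'a::topological_space \<Rightarrow> 'a"
  assumes "continuous_on X f" "f ` X \<subseteq> X"
  shows "continuous_on X (f ^^ k)"
proof (induction k)
  case 0
  show ?case by (simp add: id_def)
next
  case (Suc k)
  have "(f ^^ k) ` X \<subseteq> X"
    using funpow_mem[OF assms(2)] by blast
  then have "continuous_on X (f \<circ> (f ^^ k))"
    by (intro continuous_on_compose Suc continuous_on_subset[OF assms(1)])
  then show ?case by simp
qed

lemma finite_separated_cards:
  fixes f :: "'a::metric_space \<Rightarrow> 'a"
  assumes "compact X" "continuous_on X f" "f ` X \<subseteq> X" "\<epsilon> > 0"
  shows "finite {card E |E. separated_set X f n \<epsilon> E}"
proof -
  have "\<forall>k. \<exists>\<delta>>0. \<forall>x\<in>X. \<forall>y\<in>X. dist y x < \<delta> \<longrightarrow> dist ((f ^^ k) y) ((f ^^ k) x) < \<epsilon>"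
    using compact_uniformly_continuous[OF continuous_on_funpow[OF assms(2,3)] assms(1)] assms(4)
    unfolding uniformly_continuous_on_def by blast
  then obtain \<delta> where pos: "\<And>k. \<delta> k > 0" and
    \<delta>: "\<And>k x y. x \<in> X \<Longrightarrow> y \<in> X \<Longrightarrow> dist y x < \<delta> k \<Longrightarrow> dist ((f ^^ k) y) ((f ^^ k) x) < \<epsilon>"
    by metis
  define r where "r = Min (\<delta> ` {0..n - 1})"
  have "r > 0" unfolding r_def using pos by (subst Min_gr_iff) auto
  have r: "dyn_dist f n x y < \<epsilon>" if "x \<in> X" "y \<in> X" "dist x y < r" for x y
    unfolding dyn_dist_less_iff
  proof (intro allI impI)
    fix k assume "k \<le> n - 1"
    then have "r \<le> \<delta> k" unfolding r_def by (intro Min_le) auto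
    then show "dist ((f ^^ k) x) ((f ^^ k) y) < \<epsilon>" using \<delta> that by auto
  qed
  obtain C where C: "finite C" "X \<subseteq> (\<Union>c\<in>C. ball c (r / 2))"
    using assms(1) \<open>r > 0\<close> unfolding compact_eq_totally_bounded by (meson half_gt_zero)
  have "card E \<le> card C" if E: "separated_set X f n \<epsilon> E" for E
  proof -
    have "\<forall>x\<in>E. \<exists>c\<in>C. dist c x < r / 2"
      using C(2) E unfolding separated_set_def by fastforce
    then obtain h where h: "\<And>x. x \<in> E \<Longrightarrow> h x \<in> C \<and> dist (h x) x < r / 2" by metis
    have "inj_on h E"
    proof (rule inj_onI, rule ccontr)
      fix x y assume xy: "x \<in> E" "y \<in> E" "h x = h y" "x \<noteq> y"
      have "dist x y < r" using h[OF xy(1)] h[OF xy(2)] xy(3)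
        by (metis dist_commute dist_triangle_half_l)
      with r[of x y] E xy show False unfolding separated_set_def by force
    qed
    then show ?thesis using C(1) h by (intro card_inj_on_le) auto
  qed
  then have "{card E |E. separated_set X f n \<epsilon> E} \<subseteq> {..card C}" by auto
  then show ?thesis by (rule finite_subset) simp
qed

lemma sep_antimono:
  fixes f :: "'a::metric_space \<Rightarrow> 'a"
  assumes "compact X" "continuous_on X f" "f ` X \<subseteq> X" "0 < \<epsilon>" "\<epsilon> \<le> \<epsilon>'"
  shows "sep X f n \<epsilon>' \<le> sep X f n \<epsilon>"
  unfolding sep_def
proof (rule Max_mono)
  show "{card E |E. separated_set X f n \<epsilon>' E} \<subseteq> {card E |E. separated_set X f n \<epsilon> E}"
    using assms(5) unfolding separated_set_def by force
  have "separated_set X f n \<epsilon>' {}" by (simp add: separated_set_def)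
  then show "{card E |E. separated_set X f n \<epsilon>' E} \<noteq> {}" by blast
qed (rule finite_separated_cards[OF assms(1-4)])

lemma sep_pos:
  fixes f :: "'a::metric_space \<Rightarrow> 'a"
  assumes "compact X" "continuous_on X f" "f ` X \<subseteq> X" "0 < \<epsilon>" "X \<noteq> {}"
  shows "sep X f n \<epsilon> \<ge> 1"
proof -
  obtain x where "x \<in> X" using assms(5) by blast
  then have "separated_set X f n \<epsilon> {x}" by (simp add: separated_set_def)
  then have "card {x} \<in> {card E |E. separated_set X f n \<epsilon> E}" by blast
  then show ?thesis unfolding sep_def
    using Max_ge[OF finite_separated_cards[OF assms(1-4)]] by fastforce
qed

lemma pol_entropy_tendsto:
  fixes f :: "'a::metric_space \<Rightarrow> 'a"
  assumes "compact X" "continuous_on X f" "f ` X \<subseteq> X" "X \<noteq> {}"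
  shows "((\<lambda>\<epsilon>. limsup (\<lambda>n. ereal (ln (real (sep X f n \<epsilon>)) / ln (real n)))) \<longlongrightarrow> pol_entropy X f)
           (at_right (0::real))"
proof -
  define g where "g \<epsilon> = limsup (\<lambda>n. ereal (ln (real (sep X f n \<epsilon>)) / ln (real n)))" for \<epsilon>
  have mono: "g \<epsilon>' \<le> g \<epsilon>" if "0 < \<epsilon>" "\<epsilon> \<le> \<epsilon>'" for \<epsilon> \<epsilon>'
    unfolding g_def
  proof (intro Limsup_mono eventuallyI)
    fix n
    have "0 < sep X f n \<epsilon>'" using sep_pos[OF assms(1-3) _ assms(4), of \<epsilon>' n] that by simp
    with sep_antimono[OF assms(1-3) that, of n]
    have "ln (real (sep X f n \<epsilon>')) \<le> ln (real (sep X f n \<epsilon>))" by simp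
    then show "ereal (ln (real (sep X f n \<epsilon>')) / ln (real n))
             \<le> ereal (ln (real (sep X f n \<epsilon>)) / ln (real n))"
      by (cases n) (auto intro: divide_right_mono)
  qed
  have "(g \<longlongrightarrow> (SUP \<epsilon>\<in>{0<..}. g \<epsilon>)) (at_right 0)"
  proof (rule order_tendstoI)
    fix a assume "a < (SUP \<epsilon>\<in>{0<..}. g \<epsilon>)"
    then obtain e where e: "e > 0" "a < g e" by (auto simp: less_SUP_iff)
    have "\<forall>\<^sub>F \<epsilon> in at_right 0. \<epsilon> \<in> {0<..<e}" by (rule eventually_at_rightI[OF _ e(1)])
    then show "\<forall>\<^sub>F \<epsilon> in at_right 0. a < g \<epsilon>"
      by eventually_elim (use mono e(2) in \<open>force intro: less_le_trans\<close>)
  next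
    fix a assume a: "(SUP \<epsilon>\<in>{0<..}. g \<epsilon>) < a"
    have "\<forall>\<^sub>F \<epsilon> in at_right (0::real). \<epsilon> \<in> {0<..}" by (auto simp: eventually_at_right_less)
    then show "\<forall>\<^sub>F \<epsilon> in at_right 0. g \<epsilon> < a"
      by eventually_elim (use a in \<open>meson SUP_upper le_less_trans\<close>)
  qed
  moreover from this have "Lim (at_right 0) g = (SUP \<epsilon>\<in>{0<..}. g \<epsilon>)"
    by (intro tendsto_Lim) auto
  ultimately show ?thesis unfolding pol_entropy_def g_def by simp
qed

end

theory Submission
  imports Defs
begin

text \<open>
  The separation numbers of \<open>f\<close> grow at most linearly in \<open>n\<close>.
  Cover \<open>X\<close> by finitely many open sets of small diameter with finite boundaries, and let \<open>P\<close> be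
  the union of these boundaries. A connected subset of \<open>X\<close> that misses \<open>P\<close> lies inside a single
  member of the cover, so it is small (\<open>finite_cut_set\<close>). Let \<open>Q\<close> be the set of points of \<open>X\<close> that
  visit \<open>P\<close> at some time \<open>k < n\<close>. As the iterates of \<open>f\<close> are injective, \<open>Q\<close> has at most
  \<open>n * card P\<close> elements. The first \<open>n\<close> images of a component \<open>C\<close> of \<open>X - Q\<close> are connected and miss
  \<open>P\<close>, hence are all small.

  The complement of \<open>Q\<close> may well have infinitely many components, so counting them leads nowhere.
  Instead, boundary bumping in the continuum \<open>X\<close> says that the closure of \<open>C\<close> contains a point
  \<open>q \<in> Q\<close>, and by continuity the orbit of \<open>q\<close> stays close to that of every point of \<open>C\<close> up to
  time \<open>n\<close>. So every orbit of length \<open>n\<close> is shadowed by that of a point of \<open>Q\<close>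
  (\<open>visiting_points_span\<close>), and since two points of a separated set cannot be shadowed by the same
  point, \<open>sep X f n \<epsilon> \<le> n * card P\<close> (\<open>sep_le_linear\<close>).
  Dividing logarithms gives the bound \<open>1\<close>.
\<close>

text \<open>
  A connected set that meets an open set \<open>V\<close> but
  is not contained in it must cross the boundary of \<open>V\<close>; avoiding the boundaries of all members of
  a fine cover therefore forces a connected set to be small.
\<close>

lemma finite_cut_set:
  fixes X :: "'a::metric_space set"
  assumes "regular_curve X" "e > 0"
  obtains P where "finite P" "P \<subseteq> X" "P \<noteq> {}"
    "\<And>C x y. connected C \<Longrightarrow> C \<subseteq> X \<Longrightarrow> C \<inter> P = {} \<Longrightarrow> x \<in> C \<Longrightarrow> y \<in> C \<Longrightarrow> dist x y < e"
proof -
  have X: "X \<noteq> {}" "compact X"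
    using assms(1) by (auto simp: regular_curve_def continuum_def)
  have "\<exists>V. openin (top_of_set X) V \<and> x \<in> V \<and> V \<subseteq> X \<inter> ball x (e/2)
          \<and> finite (top_of_set X frontier_of V)" if "x \<in> X" for x
  proof -
    have "openin (top_of_set X) (X \<inter> ball x (e/2))" "x \<in> X \<inter> ball x (e/2)"
      using that assms(2) by auto
    then show ?thesis
      using assms(1) that unfolding regular_curve_def by blast
  qed
  then obtain V where V: "\<And>x. x \<in> X \<Longrightarrow> openin (top_of_set X) (V x)" "\<And>x. x \<in> X \<Longrightarrow> x \<in> V x"
      "\<And>x. x \<in> X \<Longrightarrow> V x \<subseteq> X \<inter> ball x (e/2)"
      "\<And>x. x \<in> X \<Longrightarrow> finite (top_of_set X frontier_of V x)"
    by metis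
  obtain W where W: "\<And>x. x \<in> X \<Longrightarrow> open (W x) \<and> V x = X \<inter> W x"
    using V(1) unfolding openin_open by metis
  obtain F where F: "F \<subseteq> X" "finite F" "X \<subseteq> (\<Union>x\<in>F. W x)"
    by (rule compactE_image[OF X(2), of X W]) (use V(2) W in auto)
  obtain a where a: "a \<in> X" using X(1) by blast
  \<comment> \<open>The extra point \<open>a\<close> keeps \<open>P\<close> nonempty even when every member of the cover is clopen.\<close>
  define P where "P = insert a (\<Union>x\<in>F. top_of_set X frontier_of V x)"
  show ?thesis
  proof
    show "finite P" using F V(4) by (auto simp: P_def)
    show "P \<subseteq> X"
      using a frontier_of_subset_topspace[of "top_of_set X"] by (fastforce simp: P_def)
    show "P \<noteq> {}" by (simp add: P_def)
    fix C x y
    assume C: "connected C" "C \<subseteq> X" "C \<inter> P = {}" and xy: "x \<in> C" "y \<in> C"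
    obtain z where z: "z \<in> F" "x \<in> V z"
      using F W C(2) xy(1) by blast
    have "C \<inter> top_of_set X frontier_of V z = {}"
      using C(3) z(1) by (auto simp: P_def)
    moreover have "connectedin (top_of_set X) C"
      using C by (simp add: connectedin_subtopology)
    ultimately have "C - V z = {}"
      using connectedin_Int_frontier_of[of "top_of_set X" C "V z"] xy(1) z(2) by blast
    then have "x \<in> ball z (e/2)" "y \<in> ball z (e/2)"
      using V(3) F(1) z xy by blast+
    then show "dist x y < e"
      by (metis dist_triangle_half_r mem_ball)
  qed
qed

text \<open>
  Boundary bumping provides a common boundary point of the component and of \<open>X - Q\<close>. The latter is
  open in \<open>X\<close>, hence contains none of its own boundary points, so the common point lies in \<open>Q\<close>.
\<close>

lemma component_complement_adherent:
  fixes X :: "'a::metric_space set"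
  assumes "connected X" "compact X" "closed Q" "Q \<subseteq> X" "Q \<noteq> {}" "x \<in> X - Q"
  obtains C q where "connected C" "C \<subseteq> X - Q" "x \<in> C" "q \<in> Q" "q \<in> closure C"
proof -
  let ?T = "top_of_set X"
  have "\<Union> (connected_components_of (subtopology ?T (X - Q))) = X - Q"
    by (simp add: Union_connected_components_of Int_absorb1 subtopology_subtopology)
  then obtain C where C: "C \<in> connected_components_of (subtopology ?T (X - Q))" "x \<in> C"
    using assms(6) by blast
  have conn: "connected C" "C \<subseteq> X - Q"
    using connectedin_connected_components_of[OF C(1)]
    by (auto simp: connectedin_subtopology subtopology_subtopology)
  have "?T frontier_of C \<inter> ?T frontier_of (X - Q) \<noteq> {}"
  proof (rule boundary_bumping_theorem)
    show "connected_space ?T" "compact_space ?T"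
      using assms(1,2) by (simp_all add: connected_space_subtopology compact_space_subtopology)
    show "Hausdorff_space ?T" by (simp add: Hausdorff_space_subtopology)
    show "X - Q \<subset> topspace ?T" using assms(4,5) by auto
  qed (rule C(1))
  then obtain q where q: "q \<in> ?T frontier_of C" "q \<in> ?T frontier_of (X - Q)" by blast
  have "openin ?T (X - Q)"
    using assms(3) by (metis Diff_eq open_Compl openin_open_Int)
  then have "q \<in> Q"
    using q(2) by (auto simp: frontier_of_def interior_of_openin in_closure_of)
  moreover have "q \<in> closure C"
    using q(1) closure_mono[of "X \<inter> C" C] by (auto simp: frontier_of_def closure_of_subtopology)
  ultimately show ?thesis using that conn C(2) by blast
qed

text \<open>
  The component of \<open>x\<close> in the complement of \<open>Q\<close> has small images up to time \<open>n\<close>. Passing to its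
  closure turns the strict distance bound into a non-strict one and gains the shadowing point \<open>q\<close>.
\<close>

lemma visiting_points_span:
  fixes X :: "'a::metric_space set"
  assumes X: "connected X" "compact X" and f: "continuous_on X f" "f ` X \<subseteq> X"
    and small: "\<And>C x y. connected C \<Longrightarrow> C \<subseteq> X \<Longrightarrow> C \<inter> P = {} \<Longrightarrow> x \<in> C \<Longrightarrow> y \<in> C \<Longrightarrow> dist x y < e"
    and Q: "Q = {x \<in> X. \<exists>k<n. (f ^^ k) x \<in> P}" "finite Q" "Q \<noteq> {}"
    and e: "e > 0" and x: "x \<in> X"
  obtains q where "q \<in> Q" "\<And>k. k < n \<Longrightarrow> dist ((f ^^ k) x) ((f ^^ k) q) \<le> e"
proof (cases "x \<in> Q")
  case True
  then show ?thesis using that[of x] e by simp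
next
  case False
  have "Q \<subseteq> X" using Q(1) by blast
  then obtain C q where C: "connected C" "C \<subseteq> X - Q" "x \<in> C" "q \<in> Q" "q \<in> closure C"
    by (rule component_complement_adherent[OF X finite_imp_closed[OF Q(2)] _ Q(3)])
      (use x False in auto)
  have "dist ((f ^^ k) x) ((f ^^ k) q) \<le> e" if k: "k < n" for k
  proof -
    have cont: "continuous_on X (f ^^ k)" by (rule continuous_on_funpow[OF f])
    have "connected ((f ^^ k) ` C)"
      using C(1,2) cont by (blast intro: connected_continuous_image continuous_on_subset)
    moreover have "(f ^^ k) ` C \<subseteq> X" using C(2) funpow_mem[OF f(2)] by blast
    moreover have "(f ^^ k) ` C \<inter> P = {}" using C(2) k Q(1) by blast
    ultimately have "dist ((f ^^ k) x) ((f ^^ k) y) < e" if "y \<in> C" for y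
      using small C(3) that by blast
    then have "C \<subseteq> {y \<in> X. dist ((f ^^ k) x) ((f ^^ k) y) \<le> e}"
      using C(2) by force
    moreover have "closed {y \<in> X. dist ((f ^^ k) x) ((f ^^ k) y) \<le> e}"
      by (intro continuous_on_closed_Collect_le continuous_intros cont compact_imp_closed X)
    ultimately show ?thesis
      using closure_minimal C(5) by blast
  qed
  with C(4) show ?thesis by (rule that)
qed

lemma inj_on_funpow:
  assumes "inj_on f X" "f ` X \<subseteq> X"
  shows "inj_on (f ^^ k) X"
proof (induction k)
  case (Suc k)
  have "(f ^^ k) ` X \<subseteq> X" using funpow_mem[OF assms(2)] by blast
  then have "inj_on (f \<circ> (f ^^ k)) X"
    by (intro comp_inj_on Suc inj_on_subset[OF assms(1)])
  then show ?case by (simp add: o_def)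
qed simp

lemma card_visiting_points_le:
  assumes "finite P" "inj_on f X" "f ` X \<subseteq> X"
  shows "finite {x \<in> X. \<exists>k<n. (f ^^ k) x \<in> P}" "card {x \<in> X. \<exists>k<n. (f ^^ k) x \<in> P} \<le> n * card P"
proof -
  have eq: "{x \<in> X. \<exists>k<n. (f ^^ k) x \<in> P} = (\<Union>k<n. (f ^^ k) -` P \<inter> X)" by auto
  have inj: "inj_on (f ^^ k) X" for k by (rule inj_on_funpow[OF assms(2,3)])
  show "finite {x \<in> X. \<exists>k<n. (f ^^ k) x \<in> P}"
    unfolding eq using finite_vimage_IntI[OF assms(1) inj] by blast
  have "card (\<Union>k<n. (f ^^ k) -` P \<inter> X) \<le> (\<Sum>k<n. card ((f ^^ k) -` P \<inter> X))"
    by (rule card_UN_le) simp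
  also have "\<dots> \<le> (\<Sum>k<n. card P)"
    by (intro sum_mono card_vimage_inj_on_le inj assms(1))
  finally show "card {x \<in> X. \<exists>k<n. (f ^^ k) x \<in> P} \<le> n * card P"
    unfolding eq by simp
qed

text \<open>
  The shadowing radius is \<open>\<epsilon> / 3\<close>: shadowing bounds distances only non-strictly, and two points with
  a common shadow must come out strictly closer than \<open>\<epsilon>\<close>.
\<close>

lemma sep_le_linear:
  fixes X :: "'a::metric_space set"
  assumes X: "regular_curve X" and f: "continuous_on X f" "f ` X \<subseteq> X" "inj_on f X"
    and eps: "\<epsilon> > 0"
  obtains M where "M \<ge> 1" "\<And>n. n \<ge> 1 \<Longrightarrow> sep X f n \<epsilon> \<le> n * M"
proof -
  have XX: "connected X" "compact X"
    using X by (auto simp: regular_curve_def continuum_def)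
  obtain P where P: "finite P" "P \<subseteq> X" "P \<noteq> {}" and
    small: "\<And>C x y. connected C \<Longrightarrow> C \<subseteq> X \<Longrightarrow> C \<inter> P = {} \<Longrightarrow> x \<in> C \<Longrightarrow> y \<in> C \<Longrightarrow> dist x y < \<epsilon> / 3"
    by (rule finite_cut_set[OF X, of "\<epsilon> / 3"]) (use eps in simp, blast)
  show ?thesis
  proof
    show "card P \<ge> 1" using P by (simp add: Suc_leI card_gt_0_iff)
    fix n :: nat assume n: "n \<ge> 1"
    define Q where "Q = {x \<in> X. \<exists>k<n. (f ^^ k) x \<in> P}"
    have finQ: "finite Q" and cardQ: "card Q \<le> n * card P"
      unfolding Q_def using card_visiting_points_le[OF P(1) f(3,2)] by blast+
    \<comment> \<open>A point of \<open>P\<close> visits \<open>P\<close> at time \<open>0\<close>, and \<open>0 < n\<close>.\<close>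
    have "P \<subseteq> Q" using P(2) n by (auto simp: Q_def intro!: exI[of _ 0])
    then have "Q \<noteq> {}" using P(3) by blast
    have "\<exists>q\<in>Q. \<forall>k<n. dist ((f ^^ k) x) ((f ^^ k) q) \<le> \<epsilon> / 3" if "x \<in> X" for x
      by (rule visiting_points_span[OF XX f(1,2) small Q_def finQ \<open>Q \<noteq> {}\<close> _ that])
        (use eps in auto)
    then obtain h where h: "\<And>x. x \<in> X \<Longrightarrow> h x \<in> Q"
        "\<And>x k. x \<in> X \<Longrightarrow> k < n \<Longrightarrow> dist ((f ^^ k) x) ((f ^^ k) (h x)) \<le> \<epsilon> / 3"
      by metis
    have "card E \<le> n * card P" if E: "separated_set X f n \<epsilon> E" for E
    proof -
      have EX: "E \<subseteq> X" using E by (simp add: separated_set_def)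
      have "inj_on h E"
      proof (rule inj_onI, rule ccontr)
        fix x y assume xy: "x \<in> E" "y \<in> E" "h x = h y" "x \<noteq> y"
        have "dist ((f ^^ k) x) ((f ^^ k) y) < \<epsilon>" if "k \<le> n - 1" for k
        proof -
          have k: "k < n" using that n by simp
          have "dist ((f ^^ k) x) ((f ^^ k) (h x)) \<le> \<epsilon> / 3"
               "dist ((f ^^ k) y) ((f ^^ k) (h x)) \<le> \<epsilon> / 3"
            using h(2)[OF _ k] xy EX by (metis subsetD)+
          then show ?thesis
            using dist_triangle2[of "(f ^^ k) x" "(f ^^ k) y" "(f ^^ k) (h x)"] eps by linarith
        qed
        then have "dyn_dist f n x y < \<epsilon>" by (simp add: dyn_dist_less_iff)
        with E xy show False unfolding separated_set_def by force
      qed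
      then have "card E \<le> card Q"
        using h(1) EX finQ by (intro card_inj_on_le) auto
      with cardQ show ?thesis by linarith
    qed
    moreover have "sep X f n \<epsilon> \<in> {card E |E. separated_set X f n \<epsilon> E}"
      unfolding sep_def
    proof (rule Max_in[OF finite_separated_cards[OF XX(2) f(1,2) eps]])
      have "separated_set X f n \<epsilon> {}" by (simp add: separated_set_def)
      then show "{card E |E. separated_set X f n \<epsilon> E} \<noteq> {}" by blast
    qed
    ultimately show "sep X f n \<epsilon> \<le> n * card P" by auto
  qed
qed

theorem corollary4:
  fixes X :: "'a::metric_space set" and f g :: "'a \<Rightarrow> 'a"
  assumes "regular_curve X"
    and "homeomorphism X X f g"
  shows "pol_entropy X f \<le> 1"
proof -
  have X: "compact X" "X \<noteq> {}"
    using assms(1) by (auto simp: regular_curve_def continuum_def)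
  have f: "continuous_on X f" "f ` X \<subseteq> X" "inj_on f X"
    using assms(2) by (auto simp: homeomorphism_def intro: inj_on_inverseI)
  have bound: "limsup (\<lambda>n. ereal (ln (real (sep X f n \<epsilon>)) / ln (real n))) \<le> 1" if eps: "\<epsilon> > 0" for \<epsilon>
  proof -
    obtain M where M: "M \<ge> 1" "\<And>n. n \<ge> 1 \<Longrightarrow> sep X f n \<epsilon> \<le> n * M"
      by (rule sep_le_linear[OF assms(1) f eps]) blast
    have "limsup (\<lambda>n. ereal (ln (real (sep X f n \<epsilon>)) / ln (real n)))
            \<le> limsup (\<lambda>n. ereal (1 + ln (real M) / ln (real n)))"
    proof (rule Limsup_mono, rule eventually_sequentiallyI[of 2])
      fix n :: nat assume n: "n \<ge> 2"
      have pos: "1 \<le> sep X f n \<epsilon>" by (rule sep_pos[OF X(1) f(1,2) eps X(2)])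
      have "real (sep X f n \<epsilon>) \<le> real n * real M"
        using M(2)[of n] n by (metis of_nat_le_iff of_nat_mult one_le_numeral order.trans)
      then have "ln (real (sep X f n \<epsilon>)) \<le> ln (real n * real M)"
        using pos by (intro ln_mono) auto
      also have "\<dots> = ln (real n) + ln (real M)"
        using M(1) n by (intro ln_mult_pos) auto
      finally show "ereal (ln (real (sep X f n \<epsilon>)) / ln (real n))
                      \<le> ereal (1 + ln (real M) / ln (real n))"
        using n by (simp add: field_simps)
    qed
    also have "\<dots> = 1"
    proof (rule lim_imp_Limsup)
      have "(\<lambda>n. ln (real M) / ln (real n)) \<longlonglongrightarrow> 0"
        by (intro tendsto_divide_0[OF tendsto_const] filterlim_at_top_imp_at_infinity
              filterlim_compose[OF ln_at_top filterlim_real_sequentially])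
      then have "(\<lambda>n. 1 + ln (real M) / ln (real n)) \<longlonglongrightarrow> 1 + 0"
        by (intro tendsto_add tendsto_const)
      then show "(\<lambda>n. ereal (1 + ln (real M) / ln (real n))) \<longlonglongrightarrow> 1"
        by (simp add: one_ereal_def)
    qed simp
    finally show ?thesis .
  qed
  show ?thesis
  proof (rule tendsto_upperbound[OF pol_entropy_tendsto[OF X(1) f(1,2) X(2)]])
    show "\<forall>\<^sub>F \<epsilon> in at_right 0.
        limsup (\<lambda>n. ereal (ln (real (sep X f n \<epsilon>)) / ln (real n))) \<le> 1"
      using bound by (auto intro: eventually_at_rightI[of 0 1])
  qed simp
qed

end
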